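(* Let $H$ be a bialgebra over a field $\mathbb{K}$, let $C$ be a left $H$-module coalgebra, and $F$ a finite subset of $C$. Then $F$ is contained in a submodule subcoalgebra $D$ of $C$ (i.e. $D$ is an $H$-submodule and a subcoalgebra of $C$) which is finitely generated as a left $H$-module.
   Context: A left $H$-module coalgebra is a coassociative counital coalgebra in the monoidal category ${}_H\mathcal{M}$ of left $H$-modules (tensor product $\otimes_{\mathbb{K}}$ with $h(v\otimes w)=h_1v\otimes h_2w$, unit object $\mathbb{K}$ with action via $\varepsilon$); that is, a $\mathbb{K}$-coalgebra with a left $H$-module structure whose comultiplication and counit are $H$-linear. *)

theory Defs
  imports Complex_Main "HOL-Library.Poly_Mapping"
begin

text \<open>
  Vector spaces over the field \<open>'k\<close> are types together with a scalar multiplication satisfying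
  the library locale \<^locale>\<open>vector_space\<close>.  The library has no tensor products of such spaces.
  For a space \<open>V\<close>, the spaces \<open>V \<otimes> V\<close> and \<open>V \<otimes> V \<otimes> V\<close> are constructed here in the usual way: as the
  quotient of the free vector space on \<open>V \<times> V\<close> (respectively \<open>V \<times> V \<times> V\<close>) by the subspace spanned
  by the relations that make the tensor symbol linear in each slot.  Elements of the tensor product
  are equivalence classes, and maps out of it are written as unions over representatives, as in
  \<^theory>\<open>HOL.Equiv_Relations\<close>.
\<close>

section \<open>Free vector spaces\<close>

abbreviation single :: "'i \<Rightarrow> 'k \<Rightarrow> 'i \<Rightarrow>\<^sub>0 'k::zero"
  where "single \<equiv> Poly_Mapping.single"

definition fscale :: "'k::field \<Rightarrow> ('i \<Rightarrow>\<^sub>0 'k) \<Rightarrow> ('i \<Rightarrow>\<^sub>0 'k)"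
  where "fscale k u = Poly_Mapping.map ((*) k) u"

definition lin_ext :: "('k::field \<Rightarrow> 'v::ab_group_add \<Rightarrow> 'v) \<Rightarrow> ('i \<Rightarrow> 'v) \<Rightarrow> ('i \<Rightarrow>\<^sub>0 'k) \<Rightarrow> 'v"
  where "lin_ext s f u = (\<Sum>i\<in>Poly_Mapping.keys u. s (Poly_Mapping.lookup u i) (f i))"

lemma lookup_fscale [simp]: "Poly_Mapping.lookup (fscale k u) i = k * Poly_Mapping.lookup u i"
  by (simp add: fscale_def Poly_Mapping.map.rep_eq when_def)

global_interpretation free: vector_space "fscale :: 'k::field \<Rightarrow> ('i \<Rightarrow>\<^sub>0 'k) \<Rightarrow> ('i \<Rightarrow>\<^sub>0 'k)"
  by unfold_locales (auto intro!: poly_mapping_eqI simp: lookup_add algebra_simps)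

lemma lin_ext_superset:
  assumes "vector_space s" "finite A" "Poly_Mapping.keys u \<subseteq> A"
  shows "lin_ext s f u = (\<Sum>i\<in>A. s (Poly_Mapping.lookup u i) (f i))"
proof -
  interpret vector_space s by fact
  show ?thesis unfolding lin_ext_def
    by (rule sum.mono_neutral_left) (use assms in \<open>auto simp: in_keys_iff\<close>)
qed

lemma linear_lin_ext:
  fixes f :: "'i \<Rightarrow> 'v::ab_group_add" and s :: "'k::field \<Rightarrow> 'v \<Rightarrow> 'v"
  assumes "vector_space s"
  shows "Vector_Spaces.linear fscale s (lin_ext s f)"
proof -
  interpret vector_space s by fact
  show ?thesis
  proof
    fix u v :: "'i \<Rightarrow>\<^sub>0 'k" and k :: 'k
    let ?A = "Poly_Mapping.keys u \<union> Poly_Mapping.keys v"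
    have "Poly_Mapping.keys (u + v) \<subseteq> ?A" by (rule Poly_Mapping.keys_add)
    then show "lin_ext s f (u + v) = lin_ext s f u + lin_ext s f v"
      by (simp add: lin_ext_superset[OF assms, of ?A] lookup_add scale_left_distrib sum.distrib)
    have "Poly_Mapping.keys (fscale k u) \<subseteq> Poly_Mapping.keys u" by (auto simp: in_keys_iff)
    then show "lin_ext s f (fscale k u) = s k (lin_ext s f u)"
      by (simp add: lin_ext_superset[OF assms, of "Poly_Mapping.keys u"] scale_sum_right)
  qed
qed

lemma lin_ext_single [simp]: "vector_space s \<Longrightarrow> lin_ext s f (single i k) = s k (f i)"
proof -
  assume "vector_space s"
  then interpret vector_space s .
  show ?thesis by (cases "k = 0") (auto simp: lin_ext_def)
qed

section \<open>Tensor square and tensor cube of a vector space\<close>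

text \<open>\<open>e\<close> inserts a vector into one slot of a tensor symbol whose other slots are fixed.\<close>

definition slot_relations ::
    "('k::field \<Rightarrow> 'v::ab_group_add \<Rightarrow> 'v) \<Rightarrow> ('v \<Rightarrow> 'i) \<Rightarrow> ('i \<Rightarrow>\<^sub>0 'k) set"
  where "slot_relations s e =
    {single (e (x + y)) 1 - (single (e x) 1 + single (e y) 1) | x y. True} \<union>
    {single (e (s k x)) 1 - fscale k (single (e x) 1) | k x. True}"

definition tensor2_null :: "('k::field \<Rightarrow> 'v::ab_group_add \<Rightarrow> 'v) \<Rightarrow> ('v \<times> 'v \<Rightarrow>\<^sub>0 'k) set"
  where "tensor2_null s = free.span
    (\<Union>y. slot_relations s (\<lambda>x. (x, y)) \<union> slot_relations s (\<lambda>x. (y, x)))"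

definition tensor3_null :: "('k::field \<Rightarrow> 'v::ab_group_add \<Rightarrow> 'v) \<Rightarrow> ('v \<times> 'v \<times> 'v \<Rightarrow>\<^sub>0 'k) set"
  where "tensor3_null s = free.span
    (\<Union>y z. slot_relations s (\<lambda>x. (x, y, z)) \<union> slot_relations s (\<lambda>x. (y, x, z))
          \<union> slot_relations s (\<lambda>x. (y, z, x)))"

definition tensor2_rel :: "('k::field \<Rightarrow> 'v::ab_group_add \<Rightarrow> 'v) \<Rightarrow> ('v \<times> 'v \<Rightarrow>\<^sub>0 'k) rel"
  where "tensor2_rel s = {(u, v). u - v \<in> tensor2_null s}"

definition tensor3_rel :: "('k::field \<Rightarrow> 'v::ab_group_add \<Rightarrow> 'v) \<Rightarrow> ('v \<times> 'v \<times> 'v \<Rightarrow>\<^sub>0 'k) rel"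
  where "tensor3_rel s = {(u, v). u - v \<in> tensor3_null s}"

lemma equiv_tensor2_rel: "equiv UNIV (tensor2_rel s)"
proof (rule equivI)
  have sub: "free.subspace (tensor2_null s)" by (simp add: tensor2_null_def)
  show "refl (tensor2_rel s)" using free.subspace_0[OF sub] by (auto simp: tensor2_rel_def refl_on_def)
  show "sym (tensor2_rel s)" using free.subspace_neg[OF sub] by (fastforce simp: tensor2_rel_def sym_def)
  show "trans (tensor2_rel s)"
    using free.subspace_add[OF sub] by (fastforce simp: tensor2_rel_def trans_def)
qed simp

lemma equiv_tensor3_rel: "equiv UNIV (tensor3_rel s)"
proof (rule equivI)
  have sub: "free.subspace (tensor3_null s)" by (simp add: tensor3_null_def)
  show "refl (tensor3_rel s)" using free.subspace_0[OF sub] by (auto simp: tensor3_rel_def refl_on_def)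
  show "sym (tensor3_rel s)" using free.subspace_neg[OF sub] by (fastforce simp: tensor3_rel_def sym_def)
  show "trans (tensor3_rel s)"
    using free.subspace_add[OF sub] by (fastforce simp: tensor3_rel_def trans_def)
qed simp

abbreviation tensor2_class where "tensor2_class s u \<equiv> tensor2_rel s `` {u}"
abbreviation tensor3_class where "tensor3_class s u \<equiv> tensor3_rel s `` {u}"

definition tensor2 :: "('k::field \<Rightarrow> 'v::ab_group_add \<Rightarrow> 'v) \<Rightarrow> ('v \<times> 'v \<Rightarrow>\<^sub>0 'k) set set"
  where "tensor2 s = UNIV // tensor2_rel s"

definition tensor2_add ::
    "('k::field \<Rightarrow> 'v::ab_group_add \<Rightarrow> 'v) \<Rightarrow> ('v \<times> 'v \<Rightarrow>\<^sub>0 'k) set \<Rightarrow> ('v \<times> 'v \<Rightarrow>\<^sub>0 'k) set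
      \<Rightarrow> ('v \<times> 'v \<Rightarrow>\<^sub>0 'k) set"
  where "tensor2_add s X Y = (\<Union>u\<in>X. \<Union>v\<in>Y. tensor2_class s (u + v))"

definition tensor2_scale ::
    "('k::field \<Rightarrow> 'v::ab_group_add \<Rightarrow> 'v) \<Rightarrow> 'k \<Rightarrow> ('v \<times> 'v \<Rightarrow>\<^sub>0 'k) set \<Rightarrow> ('v \<times> 'v \<Rightarrow>\<^sub>0 'k) set"
  where "tensor2_scale s k X = (\<Union>u\<in>X. tensor2_class s (fscale k u))"

text \<open>
  For a bilinear map \<open>m : A \<times> V \<rightarrow> V\<close>, the induced map \<open>(A \<otimes> A) \<times> (V \<otimes> V) \<rightarrow> V \<otimes> V\<close>,
  \<open>(a\<^sub>1 \<otimes> a\<^sub>2, v\<^sub>1 \<otimes> v\<^sub>2) \<mapsto> m a\<^sub>1 v\<^sub>1 \<otimes> m a\<^sub>2 v\<^sub>2\<close>.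
\<close>

definition free_map2 ::
    "('a \<Rightarrow> 'v \<Rightarrow> 'v) \<Rightarrow> ('a \<times> 'a \<Rightarrow>\<^sub>0 'k::field) \<Rightarrow> ('v \<times> 'v \<Rightarrow>\<^sub>0 'k) \<Rightarrow> ('v \<times> 'v \<Rightarrow>\<^sub>0 'k)"
  where "free_map2 m w u =
    lin_ext fscale (\<lambda>(a1, a2). lin_ext fscale (\<lambda>(v1, v2). single (m a1 v1, m a2 v2) 1) u) w"

lemma lin_ext_tensor2_null:
  fixes s :: "'k::field \<Rightarrow> 'v::ab_group_add \<Rightarrow> 'v" and t :: "'k \<Rightarrow> 'w::ab_group_add \<Rightarrow> 'w"
  assumes t: "vector_space t" and N: "module.subspace t N"
    and "\<And>x x' y. f (x + x', y) - (f (x, y) + f (x', y)) \<in> N"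
    and "\<And>k x y. f (s k x, y) - t k (f (x, y)) \<in> N"
    and "\<And>x y y'. f (x, y + y') - (f (x, y) + f (x, y')) \<in> N"
    and "\<And>k x y. f (x, s k y) - t k (f (x, y)) \<in> N"
    and u: "u \<in> tensor2_null s"
  shows "lin_ext t f u \<in> N"
proof -
  interpret t: vector_space t by fact
  interpret L: Vector_Spaces.linear fscale t "lin_ext t f" by (rule linear_lin_ext[OF t])
  have "free.subspace {u. lin_ext t f u \<in> N}"
    using N L.subspace_vimage[of N] by (simp add: vimage_def)
  moreover have "g \<in> {u. lin_ext t f u \<in> N}"
    if "g \<in> (\<Union>y. slot_relations s (\<lambda>x. (x, y)) \<union> slot_relations s (\<lambda>x. (y, x)))" for g
    using that assms(3-6) by (auto simp: slot_relations_def L.diff L.add L.scale t)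
  ultimately have "tensor2_null s \<subseteq> {u. lin_ext t f u \<in> N}"
    unfolding tensor2_null_def by (intro free.span_minimal subsetI)
  then show ?thesis using u by blast
qed

lemma slot_relations_add: "free.subspace N \<Longrightarrow> slot_relations s e \<subseteq> N \<Longrightarrow>
   single (e (x + y)) 1 - (single (e x) 1 + single (e y) 1) \<in> N"
  by (auto simp: slot_relations_def)
lemma slot_relations_scale: "free.subspace N \<Longrightarrow> slot_relations s e \<subseteq> N \<Longrightarrow>
   single (e (s k x)) 1 - fscale k (single (e x) 1) \<in> N"
  by (auto simp: slot_relations_def)

lemma lin_ext_fun: 
  fixes t :: "'k::field \<Rightarrow> 'w::ab_group_add \<Rightarrow> 'w"
  assumes "vector_space t" "module.subspace t N"
  assumes "\<And>i. f i - t k (g i) - t l (h i) \<in> N"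
  shows "lin_ext t f u - t k (lin_ext t g u) - t l (lin_ext t h u) \<in> N"
proof -
  interpret vector_space t by fact
  have "lin_ext t f u - t k (lin_ext t g u) - t l (lin_ext t h u)
     = (\<Sum>i\<in>Poly_Mapping.keys u. t (Poly_Mapping.lookup u i) (f i - t k (g i) - t l (h i)))"
    by (simp add: lin_ext_def scale_sum_right sum_subtractf scale_right_diff_distrib mult.commute)
  also have "\<dots> \<in> N" by (intro subspace_sum subspace_scale assms)
  finally show ?thesis .
qed

lemma free_map2_cong:
  fixes sA :: "'k::field \<Rightarrow> 'a::ab_group_add \<Rightarrow> 'a" and s :: "'k \<Rightarrow> 'v::ab_group_add \<Rightarrow> 'v"
  assumes m: "\<And>a b x. m (a + b) x = m a x + m b x" "\<And>a x y. m a (x + y) = m a x + m a y"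
     "\<And>k a x. m (sA k a) x = s k (m a x)" "\<And>k a x. m a (s k x) = s k (m a x)"
  and w: "(w, w') \<in> tensor2_rel sA" and u: "(u, u') \<in> tensor2_rel s"
  shows "(free_map2 m w u, free_map2 m w' u') \<in> tensor2_rel s"
proof -
  let ?N = "tensor2_null s"
  have vs: "vector_space (fscale :: 'k \<Rightarrow> ('v\<times>'v \<Rightarrow>\<^sub>0 'k) \<Rightarrow> _)" by (rule free.vector_space_axioms)
  have N: "free.subspace ?N" by (simp add: tensor2_null_def)
  have base: "slot_relations s (\<lambda>x. (x,y)) \<subseteq> ?N" "slot_relations s (\<lambda>x. (y,x)) \<subseteq> ?N" for y
    unfolding tensor2_null_def by (rule order_trans[OF _ free.span_superset]; blast)+
  note R = slot_relations_add[OF N base(1)] slot_relations_scale[OF N base(1)]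
     slot_relations_add[OF N base(2)] slot_relations_scale[OF N base(2)]
  note F = lin_ext_fun[OF vs N, where k=1 and l=1, simplified] lin_ext_fun[OF vs N, where l=0, simplified]
  have 1: "lin_ext fscale (\<lambda>(v1, v2). single (m a1 v1, m a2 v2) 1) z \<in> ?N" if "z \<in> ?N" for z a1 a2
    by (rule lin_ext_tensor2_null[OF vs N _ _ _ _ that]) (use R in \<open>simp_all add: m\<close>)
  interpret L: Vector_Spaces.linear fscale fscale "lin_ext fscale g" for g :: "'a\<times>'a \<Rightarrow> ('v\<times>'v \<Rightarrow>\<^sub>0 'k)"
    by (rule linear_lin_ext[OF vs])
  interpret L2: Vector_Spaces.linear fscale fscale "lin_ext fscale g" for g :: "'v\<times>'v \<Rightarrow> ('v\<times>'v \<Rightarrow>\<^sub>0 'k)"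
    by (rule linear_lin_ext[OF vs])
  have 2: "free_map2 m z u \<in> ?N" if "z \<in> tensor2_null sA" for z
    unfolding free_map2_def
    by (rule lin_ext_tensor2_null[OF vs N _ _ _ _ that])
       (use R in \<open>auto simp: m diff_diff_add[symmetric] intro!: F\<close>)
  have "free_map2 m w u - free_map2 m w' u = free_map2 m (w - w') u"
    by (simp add: free_map2_def L.diff)
  also have "\<dots> \<in> ?N" using w 2 by (simp add: tensor2_rel_def)
  finally have A: "free_map2 m w u - free_map2 m w' u \<in> ?N" .
  have "lin_ext fscale (\<lambda>(a1, a2). lin_ext fscale (\<lambda>(v1, v2). single (m a1 v1, m a2 v2) 1) u) w'
    - lin_ext fscale (\<lambda>(a1, a2). lin_ext fscale (\<lambda>(v1, v2). single (m a1 v1, m a2 v2) 1) u') w' \<in> ?N"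
    using u by (intro lin_ext_fun[OF vs N, where k=1 and l=0, simplified])
      (auto simp: tensor2_rel_def L2.diff[symmetric] intro!: 1)
  then have B: "free_map2 m w' u - free_map2 m w' u' \<in> ?N" by (simp add: free_map2_def)
  from free.subspace_add[OF N A B] show ?thesis by (simp add: tensor2_rel_def)
qed


definition tensor2_map2 ::
    "('k::field \<Rightarrow> 'v::ab_group_add \<Rightarrow> 'v) \<Rightarrow> ('a \<Rightarrow> 'v \<Rightarrow> 'v)
      \<Rightarrow> ('a \<times> 'a \<Rightarrow>\<^sub>0 'k) set \<Rightarrow> ('v \<times> 'v \<Rightarrow>\<^sub>0 'k) set \<Rightarrow> ('v \<times> 'v \<Rightarrow>\<^sub>0 'k) set"
  where "tensor2_map2 s m W X = (\<Union>w\<in>W. \<Union>u\<in>X. tensor2_class s (free_map2 m w u))"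

section \<open>Coalgebras\<close>

lemma comult_left_cong:
  fixes s :: "'k::field \<Rightarrow> 'v::ab_group_add \<Rightarrow> 'v"
  assumes add: "\<And>x y. (d (x + y), d x + d y) \<in> tensor2_rel s"
  and sc: "\<And>k x. (d (s k x), fscale k (d x)) \<in> tensor2_rel s"
  and u: "(u, u') \<in> tensor2_rel s"
  shows "(lin_ext fscale (\<lambda>(x, y). lin_ext fscale (\<lambda>(a, b). single (a, b, y) 1) (d x)) u,
    lin_ext fscale (\<lambda>(x, y). lin_ext fscale (\<lambda>(a, b). single (a, b, y) 1) (d x)) u') \<in> tensor3_rel s"
proof -
  let ?N = "tensor3_null s"
  have vs: "vector_space (fscale :: 'k \<Rightarrow> ('v\<times>'v\<times>'v \<Rightarrow>\<^sub>0 'k) \<Rightarrow> _)" by (rule free.vector_space_axioms)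
  have N: "free.subspace ?N" by (simp add: tensor3_null_def)
  have base: "slot_relations s (\<lambda>x. (x,y,z)) \<subseteq> ?N" "slot_relations s (\<lambda>x. (y,x,z)) \<subseteq> ?N"
     "slot_relations s (\<lambda>x. (y,z,x)) \<subseteq> ?N" for y z
    unfolding tensor3_null_def by (rule order_trans[OF _ free.span_superset]; blast)+
  note R = base[THEN slot_relations_add[OF N]] base[THEN slot_relations_scale[OF N]]
  note F = lin_ext_fun[OF vs N, where k=1 and l=1, simplified] lin_ext_fun[OF vs N, where l=0, simplified]
  interpret L2: Vector_Spaces.linear fscale fscale "lin_ext fscale g" for g :: "'v\<times>'v \<Rightarrow> ('v\<times>'v\<times>'v \<Rightarrow>\<^sub>0 'k)"
    by (rule linear_lin_ext[OF vs])
  have 1: "lin_ext fscale (\<lambda>(a, b). single (a, b, y) 1) z \<in> ?N" if "z \<in> tensor2_null s" for z y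
    by (rule lin_ext_tensor2_null[OF vs N _ _ _ _ that]) (use R in simp_all)
  have 2: "lin_ext fscale (\<lambda>(x, y). lin_ext fscale (\<lambda>(a, b). single (a, b, y) 1) (d x)) z \<in> ?N"
     if "z \<in> tensor2_null s" for z
    apply (rule lin_ext_tensor2_null[OF vs N _ _ _ _ that])
    using add sc 1 R
    by (auto simp: L2.diff[symmetric] L2.add[symmetric] L2.scale[symmetric] tensor2_rel_def)
       (auto simp: L2.scale diff_diff_add[symmetric] intro!: F)
  show ?thesis using 2[of "u - u'"] u by (simp add: L2.diff tensor2_rel_def tensor3_rel_def)
qed

lemma comult_right_cong:
  fixes s :: "'k::field \<Rightarrow> 'v::ab_group_add \<Rightarrow> 'v"
  assumes add: "\<And>x y. (d (x + y), d x + d y) \<in> tensor2_rel s"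
  and sc: "\<And>k x. (d (s k x), fscale k (d x)) \<in> tensor2_rel s"
  and u: "(u, u') \<in> tensor2_rel s"
  shows "(lin_ext fscale (\<lambda>(x, y). lin_ext fscale (\<lambda>(a, b). single (x, a, b) 1) (d y)) u,
    lin_ext fscale (\<lambda>(x, y). lin_ext fscale (\<lambda>(a, b). single (x, a, b) 1) (d y)) u') \<in> tensor3_rel s"
proof -
  let ?N = "tensor3_null s"
  have vs: "vector_space (fscale :: 'k \<Rightarrow> ('v\<times>'v\<times>'v \<Rightarrow>\<^sub>0 'k) \<Rightarrow> _)" by (rule free.vector_space_axioms)
  have N: "free.subspace ?N" by (simp add: tensor3_null_def)
  have base: "slot_relations s (\<lambda>x. (x,y,z)) \<subseteq> ?N" "slot_relations s (\<lambda>x. (y,x,z)) \<subseteq> ?N"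
     "slot_relations s (\<lambda>x. (y,z,x)) \<subseteq> ?N" for y z
    unfolding tensor3_null_def by (rule order_trans[OF _ free.span_superset]; blast)+
  note R = base[THEN slot_relations_add[OF N]] base[THEN slot_relations_scale[OF N]]
  note F = lin_ext_fun[OF vs N, where k=1 and l=1, simplified] lin_ext_fun[OF vs N, where l=0, simplified]
  interpret L2: Vector_Spaces.linear fscale fscale "lin_ext fscale g" for g :: "'v\<times>'v \<Rightarrow> ('v\<times>'v\<times>'v \<Rightarrow>\<^sub>0 'k)"
    by (rule linear_lin_ext[OF vs])
  have 1: "lin_ext fscale (\<lambda>(a, b). single (y, a, b) 1) z \<in> ?N" if "z \<in> tensor2_null s" for z y
    by (rule lin_ext_tensor2_null[OF vs N _ _ _ _ that]) (use R in simp_all)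
  have 2: "lin_ext fscale (\<lambda>(x, y). lin_ext fscale (\<lambda>(a, b). single (x, a, b) 1) (d y)) z \<in> ?N"
     if "z \<in> tensor2_null s" for z
    apply (rule lin_ext_tensor2_null[OF vs N _ _ _ _ that])
    using add sc 1 R
    by (auto simp: L2.diff[symmetric] L2.add[symmetric] L2.scale[symmetric] tensor2_rel_def)
       (auto simp: L2.scale diff_diff_add[symmetric] intro!: F)
  show ?thesis using 2[of "u - u'"] u by (simp add: L2.diff tensor2_rel_def tensor3_rel_def)
qed

text \<open>
  The maps \<open>\<Delta> \<otimes> id\<close> and \<open>id \<otimes> \<Delta>\<close> from \<open>V \<otimes> V\<close> to \<open>V \<otimes> V \<otimes> V\<close>.  The chosen representative of
  \<open>\<Delta> x\<close> does not affect the resulting class.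
\<close>

definition comult_left ::
    "('k::field \<Rightarrow> 'v::ab_group_add \<Rightarrow> 'v) \<Rightarrow> ('v \<Rightarrow> ('v \<times> 'v \<Rightarrow>\<^sub>0 'k) set)
      \<Rightarrow> ('v \<times> 'v \<Rightarrow>\<^sub>0 'k) set \<Rightarrow> ('v \<times> 'v \<times> 'v \<Rightarrow>\<^sub>0 'k) set"
  where "comult_left s \<Delta> X = (\<Union>u\<in>X. tensor3_class s
    (lin_ext fscale (\<lambda>(x, y). lin_ext fscale (\<lambda>(a, b). single (a, b, y) 1) (SOME d. d \<in> \<Delta> x)) u))"

definition comult_right ::
    "('k::field \<Rightarrow> 'v::ab_group_add \<Rightarrow> 'v) \<Rightarrow> ('v \<Rightarrow> ('v \<times> 'v \<Rightarrow>\<^sub>0 'k) set)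
      \<Rightarrow> ('v \<times> 'v \<Rightarrow>\<^sub>0 'k) set \<Rightarrow> ('v \<times> 'v \<times> 'v \<Rightarrow>\<^sub>0 'k) set"
  where "comult_right s \<Delta> X = (\<Union>u\<in>X. tensor3_class s
    (lin_ext fscale (\<lambda>(x, y). lin_ext fscale (\<lambda>(a, b). single (x, a, b) 1) (SOME d. d \<in> \<Delta> y)) u))"

text \<open>
  The counit axioms are \<open>(\<epsilon> \<otimes> id) \<circ> \<Delta> = id = (id \<otimes> \<epsilon>) \<circ> \<Delta>\<close> after the identifications
  \<open>K \<otimes> V \<cong> V \<cong> V \<otimes> K\<close>.
\<close>

locale coalgebra = vector_space scale
  for scale :: "'k::field \<Rightarrow> 'c::ab_group_add \<Rightarrow> 'c" +
  fixes \<Delta> :: "'c \<Rightarrow> ('c \<times> 'c \<Rightarrow>\<^sub>0 'k) set"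
    and \<epsilon> :: "'c \<Rightarrow> 'k"
  assumes comult_in: "\<Delta> x \<in> tensor2 scale"
    and comult_add: "\<Delta> (x + y) = tensor2_add scale (\<Delta> x) (\<Delta> y)"
    and comult_scale: "\<Delta> (scale k x) = tensor2_scale scale k (\<Delta> x)"
    and linear_counit: "Vector_Spaces.linear scale (*) \<epsilon>"
    and coassoc: "comult_left scale \<Delta> (\<Delta> x) = comult_right scale \<Delta> (\<Delta> x)"
    and counit_left: "u \<in> \<Delta> x \<Longrightarrow> lin_ext scale (\<lambda>(a, b). scale (\<epsilon> a) b) u = x"
    and counit_right: "u \<in> \<Delta> x \<Longrightarrow> lin_ext scale (\<lambda>(a, b). scale (\<epsilon> b) a) u = x"

text \<open>
  The last conjunct says that \<open>\<Delta>\<close> maps \<open>D\<close> into (the image in \<open>V \<otimes> V\<close> of) \<open>D \<otimes> D\<close>.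
\<close>

definition subcoalgebra ::
    "('k::field \<Rightarrow> 'c::ab_group_add \<Rightarrow> 'c) \<Rightarrow> ('c \<Rightarrow> ('c \<times> 'c \<Rightarrow>\<^sub>0 'k) set) \<Rightarrow> 'c set \<Rightarrow> bool"
  where "subcoalgebra scale \<Delta> D \<longleftrightarrow> module.subspace scale D \<and>
    (\<forall>d\<in>D. \<Delta> d \<in> tensor2_class scale ` {u. Poly_Mapping.keys u \<subseteq> D \<times> D})"

section \<open>Bialgebras and module coalgebras\<close>

locale bialgebra = coalgebra scale \<Delta> \<epsilon>
  for scale :: "'k::field \<Rightarrow> 'h::ring_1 \<Rightarrow> 'h"
    and \<Delta> :: "'h \<Rightarrow> ('h \<times> 'h \<Rightarrow>\<^sub>0 'k) set"
    and \<epsilon> :: "'h \<Rightarrow> 'k" +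
  assumes mult_scale_left: "scale k x * y = scale k (x * y)"
    and mult_scale_right: "x * scale k y = scale k (x * y)"
    and comult_one: "\<Delta> 1 = tensor2_class scale (single (1, 1) 1)"
    and comult_mult: "\<Delta> (x * y) = tensor2_map2 scale (*) (\<Delta> x) (\<Delta> y)"
    and counit_one: "\<epsilon> 1 = 1"
    and counit_mult: "\<epsilon> (x * y) = \<epsilon> x * \<epsilon> y"

locale left_module =
  fixes act :: "'h::ring_1 \<Rightarrow> 'c::ab_group_add \<Rightarrow> 'c"
  assumes act_add_left: "act (g + h) x = act g x + act h x"
    and act_add_right: "act h (x + y) = act h x + act h y"
    and act_mult: "act (g * h) x = act g (act h x)"
    and act_one: "act 1 x = x"

definition submodule :: "('h::ring_1 \<Rightarrow> 'c::ab_group_add \<Rightarrow> 'c) \<Rightarrow> 'c set \<Rightarrow> bool"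
  where "submodule act D \<longleftrightarrow>
    0 \<in> D \<and> (\<forall>x\<in>D. \<forall>y\<in>D. x + y \<in> D) \<and> (\<forall>h. \<forall>x\<in>D. act h x \<in> D)"

definition finitely_generated :: "('h::ring_1 \<Rightarrow> 'c::ab_group_add \<Rightarrow> 'c) \<Rightarrow> 'c set \<Rightarrow> bool"
  where "finitely_generated act D \<longleftrightarrow> (\<exists>S. finite S \<and> D = submodule act hull S)"

text \<open>
  \<open>act_scale\<close> expresses that the vector space structure of \<open>C\<close> is the one induced by the action of
  the algebra \<open>H\<close>; the last two axioms are the \<open>H\<close>-linearity of comultiplication and counit, where
  \<open>H\<close> acts on \<open>C \<otimes> C\<close> through its comultiplication and on \<open>K\<close> through its counit.
\<close>

locale module_coalgebra =
  H: bialgebra scaleH \<Delta>H \<epsilon>H + C: coalgebra scaleC \<Delta>C \<epsilon>C + left_module act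
  for scaleH :: "'k::field \<Rightarrow> 'h::ring_1 \<Rightarrow> 'h"
    and \<Delta>H :: "'h \<Rightarrow> ('h \<times> 'h \<Rightarrow>\<^sub>0 'k) set"
    and \<epsilon>H :: "'h \<Rightarrow> 'k"
    and scaleC :: "'k \<Rightarrow> 'c::ab_group_add \<Rightarrow> 'c"
    and \<Delta>C :: "'c \<Rightarrow> ('c \<times> 'c \<Rightarrow>\<^sub>0 'k) set"
    and \<epsilon>C :: "'c \<Rightarrow> 'k"
    and act :: "'h \<Rightarrow> 'c \<Rightarrow> 'c" +
  assumes act_scale: "act (scaleH k h) x = scaleC k (act h x)"
    and comult_act: "\<Delta>C (act h x) = tensor2_map2 scaleC act (\<Delta>H h) (\<Delta>C x)"
    and counit_act: "\<epsilon>C (act h x) = \<epsilon>H h * \<epsilon>C x"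

end

theory Submission
  imports Defs
begin

text \<open>
  The span of all \<open>(g \<otimes> id \<otimes> f) (\<Delta>\<^sub>2 c)\<close>, with \<open>c \<in> F\<close>, \<open>\<Delta>\<^sub>2\<close> the iterated comultiplication and \<open>f\<close>,
  \<open>g\<close> linear functionals, is finite-dimensional, contains \<open>F\<close> by the counit axioms, and is closed
  under the two actions of the dual algebra by coassociativity; hence it is a subcoalgebra \<open>E\<close>.  Since
  \<open>\<Delta> (h e) = \<Delta> h \<cdot> \<Delta> e\<close>, the submodule \<open>H E\<close> is again a subcoalgebra, and it is generated by a basis
  of \<open>E\<close>.
\<close>

section \<open>Multilinear maps on tensor powers\<close>

definition bilinear_on_pairs ::
    "('k::field \<Rightarrow> 'v::ab_group_add \<Rightarrow> 'v) \<Rightarrow> ('k \<Rightarrow> 'w::ab_group_add \<Rightarrow> 'w) \<Rightarrow> ('v \<times> 'v \<Rightarrow> 'w) \<Rightarrow> bool"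
  where "bilinear_on_pairs s t \<phi> \<longleftrightarrow>
    (\<forall>y. Vector_Spaces.linear s t (\<lambda>x. \<phi> (x, y))) \<and> (\<forall>x. Vector_Spaces.linear s t (\<lambda>y. \<phi> (x, y)))"

definition trilinear_on_triples ::
    "('k::field \<Rightarrow> 'v::ab_group_add \<Rightarrow> 'v) \<Rightarrow> ('k \<Rightarrow> 'w::ab_group_add \<Rightarrow> 'w) \<Rightarrow> ('v \<times> 'v \<times> 'v \<Rightarrow> 'w) \<Rightarrow> bool"
  where "trilinear_on_triples s t \<phi> \<longleftrightarrow>
    (\<forall>y z. Vector_Spaces.linear s t (\<lambda>x. \<phi> (x, y, z))) \<and>
    (\<forall>x z. Vector_Spaces.linear s t (\<lambda>y. \<phi> (x, y, z))) \<and>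
    (\<forall>x y. Vector_Spaces.linear s t (\<lambda>z. \<phi> (x, y, z)))"

lemma linear_lin_ext_comp:
  assumes "Vector_Spaces.linear s t L"
  shows "L (lin_ext s f u) = lin_ext t (\<lambda>i. L (f i)) u"
proof -
  interpret L: Vector_Spaces.linear s t L by fact
  show ?thesis by (simp add: lin_ext_def L.sum L.scale)
qed

text \<open>Universal property of the tensor square: for the target subspace {0},
  \<open>lin_ext_tensor2_null\<close> says that the extension of a bilinear map kills all
  relations.\<close>

lemma lin_ext_tensor2_cong:
  assumes "bilinear_on_pairs s t \<phi>" "(u, u') \<in> tensor2_rel s"
  shows "lin_ext t \<phi> u = lin_ext t \<phi> u'"
proof -
  have t: "vector_space t"
    using assms(1) by (simp add: bilinear_on_pairs_def Vector_Spaces.linear_iff)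
  interpret t: vector_space t by fact
  interpret L: Vector_Spaces.linear fscale t "lin_ext t \<phi>" by (rule linear_lin_ext[OF t])
  have "lin_ext t \<phi> (u - u') \<in> {0}"
    by (rule lin_ext_tensor2_null[OF t t.subspace_single_0, where s = s])
      (use assms in \<open>auto simp: bilinear_on_pairs_def Vector_Spaces.linear_iff tensor2_rel_def\<close>)
  then show ?thesis by (simp add: L.diff)
qed

lemma lin_ext_tensor3_cong:
  assumes \<phi>: "trilinear_on_triples s t \<phi>" and "(u, u') \<in> tensor3_rel s"
  shows "lin_ext t \<phi> u = lin_ext t \<phi> u'"
proof -
  have t: "vector_space t"
    using \<phi> by (simp add: trilinear_on_triples_def Vector_Spaces.linear_iff)
  interpret t: vector_space t by fact
  interpret L: Vector_Spaces.linear fscale t "lin_ext t \<phi>" by (rule linear_lin_ext[OF t])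
  have "tensor3_null s \<subseteq> {u. lin_ext t \<phi> u = 0}"
    unfolding tensor3_null_def
    by (intro free.span_minimal L.subspace_kernel subsetI)
      (use \<phi> in \<open>auto simp: slot_relations_def L.diff L.add L.scale t
        trilinear_on_triples_def Vector_Spaces.linear_iff\<close>)
  then have "lin_ext t \<phi> (u - u') = 0" using assms(2) by (auto simp: tensor3_rel_def)
  then show ?thesis by (simp add: L.diff)
qed

section \<open>Expansion of tensors along a basis\<close>

lemma slot_relations_sum:
  assumes "vector_space s" and N: "free.subspace N" and e: "slot_relations s e \<subseteq> N"
  shows "single (e (\<Sum>i\<in>I. s (k i) (x i))) 1 - (\<Sum>i\<in>I. fscale (k i) (single (e (x i)) 1)) \<in> N"
proof -
  interpret vector_space s by fact
  \<comment> \<open>The scaling relation at the scalar 0 puts the symbol of the zero vector into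
    \<open>N\<close>; this settles empty and infinite \<open>I\<close>.\<close>
  have zero: "single (e 0) 1 \<in> N"
    using slot_relations_scale[OF N e, of 0 0] by simp
  show ?thesis
  proof (induction I rule: infinite_finite_induct)
    case (insert j I)
    let ?S = "\<Sum>i\<in>I. s (k i) (x i)"
    have "single (e (s (k j) (x j) + ?S)) 1 - (single (e (s (k j) (x j))) 1 + single (e ?S) 1) \<in> N"
      "single (e (s (k j) (x j))) 1 - fscale (k j) (single (e (x j)) 1) \<in> N"
      using slot_relations_add[OF N e] slot_relations_scale[OF N e] by blast+
    from free.subspace_add[OF N free.subspace_add[OF N this] insert.IH] show ?case
      using insert.hyps by (simp add: algebra_simps)
  qed (use zero in simp_all)
qed

text \<open>
  Stated for an abstract pair of slots, with \<open>e x y\<close> standing for \<open>x \<otimes> y\<close> or \<open>y \<otimes> x\<close>, so that both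
  tensor factors are covered.
\<close>

lemma tensor2_expand:
  fixes s :: "'k::field \<Rightarrow> 'v::ab_group_add \<Rightarrow> 'v"
  assumes s: "vector_space s"
    and e: "\<And>y. slot_relations s (\<lambda>x. e x y) \<subseteq> tensor2_null s"
      "\<And>x. slot_relations s (\<lambda>y. e x y) \<subseteq> tensor2_null s"
    and pr: "\<And>p. e (pr1 p) (pr2 p) = p"
    and A: "\<And>p. p \<in> Poly_Mapping.keys u \<Longrightarrow> (\<Sum>b\<in>A. s (f b (pr1 p)) b) = pr1 p"
  shows "(u, \<Sum>b\<in>A. single (e b (lin_ext s (\<lambda>p. s (f b (pr1 p)) (pr2 p)) u)) 1) \<in> tensor2_rel s"
proof -
  interpret vector_space s by fact
  let ?N = "tensor2_null s" and ?K = "Poly_Mapping.keys u" and ?c = "Poly_Mapping.lookup u"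
  have N: "free.subspace ?N" by (simp add: tensor2_null_def)
  have u: "u = (\<Sum>p\<in>?K. fscale (?c p) (single p 1))"
    by (rule poly_mapping_eqI)
      (auto simp: lookup_sum lookup_single when_def in_keys_iff if_distrib cong: if_cong)
  have "single p 1 - (\<Sum>b\<in>A. fscale (f b (pr1 p)) (single (e b (pr2 p)) 1)) \<in> ?N" if "p \<in> ?K" for p
    using slot_relations_sum[OF s N e(1)[of "pr2 p"], where I = A and x = "\<lambda>b. b" and k = "\<lambda>b. f b (pr1 p)"]
    by (simp add: A[OF that] pr)
  then have "(\<Sum>p\<in>?K. fscale (?c p)
      (single p 1 - (\<Sum>b\<in>A. fscale (f b (pr1 p)) (single (e b (pr2 p)) 1)))) \<in> ?N"
    by (intro free.subspace_sum[OF N] free.subspace_scale[OF N])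
  then have 1: "u - (\<Sum>b\<in>A. \<Sum>p\<in>?K. fscale (?c p * f b (pr1 p)) (single (e b (pr2 p)) 1)) \<in> ?N"
    unfolding free.scale_right_diff_distrib sum_subtractf u[symmetric] free.scale_sum_right
    by (subst sum.swap) simp
  \<comment> \<open>Linearity in the other slot merges all vectors paired with the same
    \<open>b\<close> into one.\<close>
  have "(\<Sum>b\<in>A. single (e b (\<Sum>p\<in>?K. s (?c p * f b (pr1 p)) (pr2 p))) 1
      - (\<Sum>p\<in>?K. fscale (?c p * f b (pr1 p)) (single (e b (pr2 p)) 1))) \<in> ?N"
    by (intro free.subspace_sum[OF N] slot_relations_sum[OF s N e(2)])
  from free.subspace_diff[OF N 1 this] show ?thesis
    by (simp add: tensor2_rel_def sum_subtractf lin_ext_def)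
qed

section \<open>The actions of linear functionals on a coalgebra\<close>

context coalgebra
begin

abbreviation functional :: "('c \<Rightarrow> 'k) \<Rightarrow> bool"
  where "functional \<equiv> Vector_Spaces.linear scale (*)"

text \<open>Literally the choice made inside \<open>comult_left\<close> and
  \<open>comult_right\<close>, so that both can be folded to \<open>rep\<close>.\<close>

definition rep :: "'c \<Rightarrow> ('c \<times> 'c \<Rightarrow>\<^sub>0 'k)"
  where "rep x = (SOME d. d \<in> \<Delta> x)"

text \<open>
  \<open>lact f x\<close> and \<open>ract g x\<close> are \<open>(id \<otimes> f) (\<Delta> x)\<close> and \<open>(g \<otimes> id) (\<Delta> x)\<close>, the left and right actions of
  the dual algebra, whose multiplication is \<open>conv\<close>.
\<close>

definition lact :: "('c \<Rightarrow> 'k) \<Rightarrow> 'c \<Rightarrow> 'c"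
  where "lact f x = lin_ext scale (\<lambda>(a, b). scale (f b) a) (rep x)"

definition ract :: "('c \<Rightarrow> 'k) \<Rightarrow> 'c \<Rightarrow> 'c"
  where "ract g x = lin_ext scale (\<lambda>(a, b). scale (g a) b) (rep x)"

definition conv :: "('c \<Rightarrow> 'k) \<Rightarrow> ('c \<Rightarrow> 'k) \<Rightarrow> 'c \<Rightarrow> 'k"
  where "conv f g x = lin_ext (*) (\<lambda>(a, b). f a * g b) (rep x)"

lemma vector_space_field: "vector_space ((*) :: 'k \<Rightarrow> 'k \<Rightarrow> 'k)"
  by unfold_locales (simp_all add: algebra_simps)

lemma vector_space_scale: "vector_space scale"
  by unfold_locales

lemma comult_eq_class: "u \<in> \<Delta> x \<Longrightarrow> \<Delta> x = tensor2_class scale u"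
  using comult_in[of x] equiv_tensor2_rel[of scale] unfolding tensor2_def
  by (metis Image_singleton_iff equiv_class_eq quotientE)

lemma rep_in: "rep x \<in> \<Delta> x"
proof -
  have "\<Delta> x \<noteq> {}"
    using comult_in[of x] equiv_tensor2_rel[of scale] in_quotient_imp_non_empty
    unfolding tensor2_def by blast
  then show ?thesis unfolding rep_def by (simp add: some_in_eq)
qed

lemma comult_rep: "\<Delta> x = tensor2_class scale (rep x)"
  by (rule comult_eq_class[OF rep_in])

lemma comult_add_rep: "u \<in> \<Delta> x \<Longrightarrow> v \<in> \<Delta> y \<Longrightarrow> u + v \<in> \<Delta> (x + y)"
  using equiv_class_self[OF equiv_tensor2_rel, of "u + v" scale]
  by (auto simp: comult_add tensor2_add_def)

lemma comult_scale_rep: "u \<in> \<Delta> x \<Longrightarrow> fscale k u \<in> \<Delta> (scale k x)"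
  using equiv_class_self[OF equiv_tensor2_rel, of "fscale k u" scale]
  by (auto simp: comult_scale tensor2_scale_def)

lemma rep_rel: "u \<in> \<Delta> x \<Longrightarrow> (rep x, u) \<in> tensor2_rel scale"
  using comult_rep[of x] by simp

lemma rep_add: "(rep (x + y), rep x + rep y) \<in> tensor2_rel scale"
  by (intro rep_rel comult_add_rep rep_in)

lemma rep_scale: "(rep (scale k x), fscale k (rep x)) \<in> tensor2_rel scale"
  by (intro rep_rel comult_scale_rep rep_in)

text \<open>\<open>rep\<close> is linear only modulo the tensor relations, and a bilinear map does
  not see the difference.\<close>

lemma linear_bilinear_rep:
  assumes "bilinear_on_pairs scale t \<phi>"
  shows "Vector_Spaces.linear scale t (\<lambda>x. lin_ext t \<phi> (rep x))"
proof -
  have t: "vector_space t"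
    using assms by (simp add: bilinear_on_pairs_def Vector_Spaces.linear_iff)
  interpret L: Vector_Spaces.linear fscale t "lin_ext t \<phi>" by (rule linear_lin_ext[OF t])
  show ?thesis
    using lin_ext_tensor2_cong[OF assms rep_add] lin_ext_tensor2_cong[OF assms rep_scale]
    by (simp add: Vector_Spaces.linear_iff t vector_space_scale L.add L.scale)
qed

text \<open>Coassociativity equates two classes in the tensor cube, and the extension of a trilinear
  map is constant on classes. Suitable choices of \<open>\<phi>\<close> give the composition laws of
  \<open>lact\<close> and \<open>ract\<close>.\<close>

lemma coassoc_eval:
  assumes \<phi>: "trilinear_on_triples scale t \<phi>"
  shows "lin_ext t (\<lambda>(x, y). lin_ext t (\<lambda>(a, b). \<phi> (a, b, y)) (rep x)) (rep z) =
    lin_ext t (\<lambda>(x, y). lin_ext t (\<lambda>(a, b). \<phi> (x, a, b)) (rep y)) (rep z)"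
proof -
  have t: "vector_space t"
    using \<phi> by (simp add: trilinear_on_triples_def Vector_Spaces.linear_iff)
  interpret t: vector_space t by fact
  note lin = linear_lin_ext_comp[OF linear_lin_ext[OF t, of \<phi>]]
  let ?l = "\<lambda>u. lin_ext fscale (\<lambda>(x, y). lin_ext fscale (\<lambda>(a, b). single (a, b, y) 1) (rep x)) u"
  let ?r = "\<lambda>u. lin_ext fscale (\<lambda>(x, y). lin_ext fscale (\<lambda>(a, b). single (x, a, b) 1) (rep y)) u"
  \<comment> \<open>Both maps respect \<open>tensor2_rel\<close>, so the unions over all
    representatives of \<open>\<Delta> z\<close> collapse to the class obtained from
    \<open>rep z\<close>.\<close>
  have l: "(?l u, ?l v) \<in> tensor3_rel scale" and r: "(?r u, ?r v) \<in> tensor3_rel scale"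
    if "(u, v) \<in> tensor2_rel scale" for u v
    using comult_left_cong[OF rep_add rep_scale that] comult_right_cong[OF rep_add rep_scale that]
    by simp_all
  have "comult_left scale \<Delta> (\<Delta> z) = tensor3_class scale (?l (rep z))"
    unfolding comult_left_def rep_def[symmetric]
    using rep_in rep_rel l equiv_class_eq[OF equiv_tensor3_rel] by blast
  moreover have "comult_right scale \<Delta> (\<Delta> z) = tensor3_class scale (?r (rep z))"
    unfolding comult_right_def rep_def[symmetric]
    using rep_in rep_rel r equiv_class_eq[OF equiv_tensor3_rel] by blast
  ultimately have "(?l (rep z), ?r (rep z)) \<in> tensor3_rel scale"
    using coassoc[of z] by (intro eq_equiv_class[OF _ equiv_tensor3_rel]) simp_all
  from lin_ext_tensor3_cong[OF \<phi> this] show ?thesis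
    by (simp add: lin case_prod_beta' t)
qed

lemma bilinear_lact: "functional f \<Longrightarrow> bilinear_on_pairs scale scale (\<lambda>(a, b). scale (f b) a)"
  by (simp add: bilinear_on_pairs_def Vector_Spaces.linear_iff vector_space_scale algebra_simps)

lemma bilinear_ract: "functional g \<Longrightarrow> bilinear_on_pairs scale scale (\<lambda>(a, b). scale (g a) b)"
  by (simp add: bilinear_on_pairs_def Vector_Spaces.linear_iff vector_space_scale algebra_simps)

lemma linear_lact: "functional f \<Longrightarrow> Vector_Spaces.linear scale scale (lact f)"
  unfolding lact_def by (rule linear_bilinear_rep[OF bilinear_lact])

lemma linear_ract: "functional g \<Longrightarrow> Vector_Spaces.linear scale scale (ract g)"
  unfolding ract_def by (rule linear_bilinear_rep[OF bilinear_ract])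

lemma functional_conv: "functional f \<Longrightarrow> functional g \<Longrightarrow> functional (conv f g)"
  unfolding conv_def
  by (rule linear_bilinear_rep)
    (simp add: bilinear_on_pairs_def Vector_Spaces.linear_iff vector_space_scale vector_space_field algebra_simps)

lemma lact_rep: "functional f \<Longrightarrow> u \<in> \<Delta> x \<Longrightarrow> lact f x = lin_ext scale (\<lambda>(a, b). scale (f b) a) u"
  unfolding lact_def by (rule lin_ext_tensor2_cong[OF bilinear_lact rep_rel])

lemma ract_rep: "functional g \<Longrightarrow> u \<in> \<Delta> x \<Longrightarrow> ract g x = lin_ext scale (\<lambda>(a, b). scale (g a) b) u"
  unfolding ract_def by (rule lin_ext_tensor2_cong[OF bilinear_ract rep_rel])

lemma lact_counit: "lact \<epsilon> x = x"
  unfolding lact_def by (rule counit_right[OF rep_in])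

lemma ract_counit: "ract \<epsilon> x = x"
  unfolding ract_def by (rule counit_left[OF rep_in])

lemma lin_ext_scale:
  "scale k (lin_ext scale f u) = lin_ext scale (\<lambda>i. scale k (f i)) u"
  "scale (lin_ext (*) h u) x = lin_ext scale (\<lambda>i. scale (h i) x) u"
  by (simp_all add: lin_ext_def scale_sum_right scale_sum_left mult.commute)

lemma lact_scale: "functional f \<Longrightarrow> lact f (scale k x) = scale k (lact f x)"
  using linear_lact by (simp add: Vector_Spaces.linear_iff)

lemma ract_scale: "functional g \<Longrightarrow> ract g (scale k x) = scale k (ract g x)"
  using linear_ract by (simp add: Vector_Spaces.linear_iff)

text \<open>The two sides are the two bracketings of the iterated comultiplication, evaluated by
  \<open>scale (f b * g c) a\<close>.\<close>

lemma lact_lact: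
  assumes f: "functional f" and g: "functional g"
  shows "lact f (lact g x) = lact (conv f g) x"
proof -
  have "trilinear_on_triples scale scale (\<lambda>(a, b, c). scale (f b * g c) a)"
    using f g by (simp add: trilinear_on_triples_def Vector_Spaces.linear_iff vector_space_scale algebra_simps)
  from coassoc_eval[OF this, of x] show ?thesis
    unfolding lact_def[of g] linear_lin_ext_comp[OF linear_lact[OF f]]
    by (simp add: lact_scale[OF f] case_prod_beta')
      (simp add: lact_def conv_def case_prod_beta' lin_ext_scale mult.commute)
qed

text \<open>Mirror image of \<open>lact_lact\<close>: the functional applied first is now the left
  factor of the convolution.\<close>

lemma ract_ract:
  assumes f: "functional f" and g: "functional g"
  shows "ract g (ract f x) = ract (conv f g) x"
proof -
  have "trilinear_on_triples scale scale (\<lambda>(a, b, c). scale (f a * g b) c)"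
    using f g by (simp add: trilinear_on_triples_def Vector_Spaces.linear_iff vector_space_scale algebra_simps)
  from coassoc_eval[OF this, of x] show ?thesis
    unfolding ract_def[of f] linear_lin_ext_comp[OF linear_ract[OF g]]
    by (simp add: ract_scale[OF g] case_prod_beta')
      (simp add: ract_def conv_def case_prod_beta' lin_ext_scale mult.commute)
qed

text \<open>The functionals consume the two outer factors, and the middle one survives under either
  bracketing.\<close>

lemma lact_ract:
  assumes f: "functional f" and g: "functional g"
  shows "lact f (ract g x) = ract g (lact f x)"
proof -
  have "trilinear_on_triples scale scale (\<lambda>(a, b, c). scale (g a * f c) b)"
    using f g by (simp add: trilinear_on_triples_def Vector_Spaces.linear_iff vector_space_scale algebra_simps)
  from coassoc_eval[OF this, of x] show ?thesis
    unfolding ract_def[of g x] lact_def[of f x]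
      linear_lin_ext_comp[OF linear_ract[OF g]] linear_lin_ext_comp[OF linear_lact[OF f]]
    by (simp add: ract_scale[OF g] lact_scale[OF f] case_prod_beta')
      (simp add: ract_def lact_def case_prod_beta' lin_ext_scale mult.commute)
qed

section \<open>The fundamental theorem of coalgebras\<close>

text \<open>\<open>A\<close> may exceed the support of \<open>x\<close>, so that one finite set
  serves all vectors occurring in a tensor.\<close>

lemma representation_sum:
  assumes B: "independent B" "span B = UNIV" and A: "finite A" "\<And>b. representation B x b \<noteq> 0 \<Longrightarrow> b \<in> A"
  shows "(\<Sum>b\<in>A. scale (representation B x b) b) = x"
proof -
  have "(\<Sum>b\<in>A. scale (representation B x b) b)
      = (\<Sum>b | representation B x b \<noteq> 0. scale (representation B x b) b)"
    using A by (intro sum.mono_neutral_right) auto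
  also have "\<dots> = x" using B by (simp add: sum_nonzero_representation_eq)
  finally show ?thesis .
qed

lemma functional_representation:
  assumes "independent B" "span B = UNIV"
  shows "functional (\<lambda>x. representation B x b)"
  using assms
  by (simp add: Vector_Spaces.linear_iff vector_space_scale vector_space_field
      representation_add representation_scale)

text \<open>
  Expanding \<open>\<Delta> d\<close> along a basis \<open>B\<close> of \<open>C\<close> gives \<open>\<Sum>b. lact b* d \<otimes> b\<close>, which lies in \<open>D \<otimes> C\<close>;
  expanding this along a basis \<open>B\<^sub>D \<subseteq> B\<close> of \<open>D\<close> gives \<open>\<Sum>b. b \<otimes> ract b* d\<close> over \<open>b \<in> B\<^sub>D\<close>, which lies
  in \<open>D \<otimes> D\<close>.
\<close>

lemma subcoalgebra_if_closed:
  assumes D: "subspace D"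
    and lact: "\<And>f d. functional f \<Longrightarrow> d \<in> D \<Longrightarrow> lact f d \<in> D"
    and ract: "\<And>f d. functional f \<Longrightarrow> d \<in> D \<Longrightarrow> ract f d \<in> D"
  shows "subcoalgebra scale \<Delta> D"
  unfolding subcoalgebra_def
proof (intro conjI ballI D)
  fix d assume d: "d \<in> D"
  obtain BD where BD: "BD \<subseteq> D" "independent BD" "D \<subseteq> span BD"
    using basis_exists[of D] by metis
  \<comment> \<open>Extending a basis of \<open>D\<close> to the whole space makes the coordinates
    functionals defined everywhere; those outside \<open>BD\<close> vanish on
    \<open>D\<close>.\<close>
  define B where "B = extend_basis BD"
  have B: "independent B" "span B = UNIV" and "BD \<subseteq> B"
    using BD(2) by (simp_all add: B_def independent_extend_basis span_extend_basis extend_basis_superset)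
  define coord where "coord b x = representation B x b" for b x
  have fun_coord: "functional (coord b)" for b
    unfolding coord_def by (rule functional_representation[OF B])
  have coord_BD: "b \<in> BD" if "x \<in> D" "coord b x \<noteq> 0" for b x
    using that BD \<open>BD \<subseteq> B\<close> B(1) representation_ne_zero
    unfolding coord_def by (metis representation_extend subsetD)
  have base: "slot_relations scale (\<lambda>x. (x, y)) \<subseteq> tensor2_null scale"
    "slot_relations scale (\<lambda>x. (y, x)) \<subseteq> tensor2_null scale" for y
    unfolding tensor2_null_def by (rule order_trans[OF _ free.span_superset]; blast)+
  have fin: "finite {b. coord b x \<noteq> 0}" for x
    unfolding coord_def by (rule finite_representation)

  define u where "u = rep d"
  define A where "A = (\<Union>p\<in>Poly_Mapping.keys u. {b. coord b (snd p) \<noteq> 0})"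
  have "finite A" unfolding A_def by (simp add: fin)
  define u1 where "u1 = (\<Sum>b\<in>A. single (lact (coord b) d, b) (1::'k))"
  \<comment> \<open>The second factor is expanded here, hence the swapped \<open>e\<close>.\<close>
  have "(u, \<Sum>b\<in>A. single (lin_ext scale (\<lambda>p. scale (coord b (snd p)) (fst p)) u, b) 1)
      \<in> tensor2_rel scale"
    by (rule tensor2_expand[OF vector_space_scale, where e = "\<lambda>x y. (y, x)"])
      (use base \<open>finite A\<close> in \<open>auto simp: A_def coord_def intro!: representation_sum[OF B]\<close>)
  also have "(\<Sum>b\<in>A. single (lin_ext scale (\<lambda>p. scale (coord b (snd p)) (fst p)) u, b) 1) = u1"
    by (simp add: u1_def u_def lact_def case_prod_beta')
  finally have rel1: "(u, u1) \<in> tensor2_rel scale" .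
  have \<Delta>1: "\<Delta> d = tensor2_class scale u1"
    using comult_rep[of d] equiv_class_eq[OF equiv_tensor2_rel rel1] by (simp add: u_def)
  then have u1: "u1 \<in> \<Delta> d"
    using equiv_class_self[OF equiv_tensor2_rel, of u1 scale] by simp
  have keys1: "fst p \<in> D" if "p \<in> Poly_Mapping.keys u1" for p
  proof -
    have "Poly_Mapping.keys u1 \<subseteq> (\<Union>b\<in>A. Poly_Mapping.keys (single (lact (coord b) d, b) (1::'k)))"
      unfolding u1_def by (rule keys_sum)
    also have "\<dots> \<subseteq> D \<times> UNIV" using lact[OF fun_coord d] by auto
    finally show ?thesis using that by auto
  qed

  define A' where "A' = (\<Union>p\<in>Poly_Mapping.keys u1. {b. coord b (fst p) \<noteq> 0})"
  have "finite A'" unfolding A'_def by (simp add: fin)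
  \<comment> \<open>The first factors of \<open>u1\<close> lie in \<open>D\<close>, so only basis
    vectors from \<open>BD\<close> occur and the new first factors stay in \<open>D\<close>.\<close>
  have "A' \<subseteq> BD" unfolding A'_def using coord_BD keys1 by blast
  define u2 where "u2 = (\<Sum>b\<in>A'. single (b, ract (coord b) d) (1::'k))"
  have "(u1, \<Sum>b\<in>A'. single (b, lin_ext scale (\<lambda>p. scale (coord b (fst p)) (snd p)) u1) 1)
      \<in> tensor2_rel scale"
    by (rule tensor2_expand[OF vector_space_scale, where e = Pair])
      (use base \<open>finite A'\<close> in \<open>auto simp: A'_def coord_def intro!: representation_sum[OF B]\<close>)
  also have "(\<Sum>b\<in>A'. single (b, lin_ext scale (\<lambda>p. scale (coord b (fst p)) (snd p)) u1) 1) = u2"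
    by (simp add: u2_def ract_rep[OF fun_coord u1] case_prod_beta')
  finally have "\<Delta> d = tensor2_class scale u2"
    using \<Delta>1 equiv_class_eq[OF equiv_tensor2_rel] by metis
  moreover have "Poly_Mapping.keys u2 \<subseteq> D \<times> D"
  proof -
    have "Poly_Mapping.keys u2 \<subseteq> (\<Union>b\<in>A'. Poly_Mapping.keys (single (b, ract (coord b) d) (1::'k)))"
      unfolding u2_def by (rule keys_sum)
    also have "\<dots> \<subseteq> D \<times> D" using ract[OF fun_coord d] \<open>A' \<subseteq> BD\<close> BD(1) by auto
    finally show ?thesis .
  qed
  ultimately show "\<Delta> d \<in> tensor2_class scale ` {u. Poly_Mapping.keys u \<subseteq> D \<times> D}" by blast
qed

lemma lin_ext_in_span:
  assumes "\<And>p. p \<in> Poly_Mapping.keys u \<Longrightarrow> h p \<in> S"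
  shows "lin_ext scale (\<lambda>p. scale (k p) (h p)) u \<in> span S"
  unfolding lin_ext_def using assms by (intro span_sum span_scale span_base)

theorem fundamental_theorem_of_coalgebras:
  assumes "finite F"
  obtains B where "finite B" "F \<subseteq> span B" "subcoalgebra scale \<Delta> (span B)"
proof -
  define G where "G = {lact f (ract g c) | f g c. functional f \<and> functional g \<and> c \<in> F}"
  have linear_closed: "L x \<in> span G"
    if L: "Vector_Spaces.linear scale scale L" and "L ` G \<subseteq> G" and x: "x \<in> span G" for L x
  proof -
    interpret L: Vector_Spaces.linear scale scale L by fact
    show ?thesis using x \<open>L ` G \<subseteq> G\<close> L.span_image[of G] span_mono by blast
  qed
  have "lact f ` G \<subseteq> G" if f: "functional f" for f
    using functional_conv[OF f] lact_lact[OF f] unfolding G_def by fastforce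
  \<comment> \<open>\<open>ract g\<close> passes \<open>lact f\<close> by \<open>lact_ract\<close>,
    then merges with the inner \<open>ract\<close> through \<open>conv\<close>.\<close>
  moreover have "ract g ` G \<subseteq> G" if g: "functional g" for g
    using functional_conv[OF _ g] ract_ract[OF _ g] lact_ract[OF _ g, symmetric] unfolding G_def
    by fastforce
  ultimately have sub: "subcoalgebra scale \<Delta> (span G)"
    by (intro subcoalgebra_if_closed subspace_span) (blast intro: linear_closed linear_lact linear_ract)+
  have "F \<subseteq> G"
  proof
    fix c assume "c \<in> F"
    moreover have "c = lact \<epsilon> (ract \<epsilon> c)" by (simp add: lact_counit ract_counit)
    ultimately show "c \<in> G" unfolding G_def using linear_counit by blast
  qed

  \<comment> \<open>The middle factors of the iterated comultiplications of the \<open>c\<close> in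
    \<open>F\<close>: a finite set independent of the functionals, so its span bounds the dimension
    of \<open>span G\<close>.\<close>
  define S where "S = (\<Union>c\<in>F. \<Union>p\<in>Poly_Mapping.keys (rep c). fst ` Poly_Mapping.keys (rep (snd p)))"
  have "finite S" unfolding S_def using assms by simp
  have "G \<subseteq> span S"
  proof (clarsimp simp: G_def)
    fix f g c assume f: "functional f" and g: "functional g" and c: "c \<in> F"
    interpret L: Vector_Spaces.linear scale scale "lact f" by (rule linear_lact[OF f])
    let ?T = "snd ` Poly_Mapping.keys (rep c)"
    have "lact f x \<in> span S" if "x \<in> ?T" for x
      unfolding lact_def case_prod_beta' using that c
      by (intro lin_ext_in_span) (force simp: S_def)
    then have "span (lact f ` ?T) \<subseteq> span S" by (intro span_minimal) auto
    moreover have "ract g c \<in> span ?T"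
      unfolding ract_def case_prod_beta' by (rule lin_ext_in_span) simp
    ultimately show "lact f (ract g c) \<in> span S" using L.span_image by blast
  qed
  obtain B where B: "B \<subseteq> G" "independent B" "G \<subseteq> span B"
    using maximal_independent_subset[of G] by metis
  then have "span B = span G" by (metis span_mono span_span subset_antisym)
  moreover have "finite B"
    using independent_span_bound[OF \<open>finite S\<close>] B \<open>G \<subseteq> span S\<close> by blast
  ultimately show thesis using that sub B(3) \<open>F \<subseteq> G\<close> by simp
qed

end

section \<open>Module coalgebras\<close>

lemma hull_submodule: "submodule act (submodule act hull S)"
  by (rule hull_in) (simp add: submodule_def)

text \<open>\<open>m\<close> acts on each slot separately, and scaling never enlarges a support; the
  keys of \<open>w\<close> are thus unconstrained.\<close>

lemma keys_free_map2:
  fixes m :: "'a \<Rightarrow> 'c \<Rightarrow> 'c" and w :: "'a \<times> 'a \<Rightarrow>\<^sub>0 'b::field"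
  assumes u: "Poly_Mapping.keys u \<subseteq> D \<times> D" and m: "\<And>a x. x \<in> D \<Longrightarrow> m a x \<in> D"
  shows "Poly_Mapping.keys (free_map2 m w u) \<subseteq> D \<times> D"
proof -
  have fscale: "Poly_Mapping.keys (fscale k v) \<subseteq> Poly_Mapping.keys v" for k :: 'b and v :: "'c \<times> 'c \<Rightarrow>\<^sub>0 'b"
    by (auto simp: in_keys_iff)
  have "Poly_Mapping.keys (lin_ext fscale (\<lambda>(x, y). single (m a x, m b y) 1) u) \<subseteq> D \<times> D" for a b
    unfolding lin_ext_def
  proof (intro order_trans[OF keys_sum] UN_least order_trans[OF fscale])
    fix p assume "p \<in> Poly_Mapping.keys u"
    then have "fst p \<in> D" "snd p \<in> D" using u by auto
    then show "Poly_Mapping.keys (case p of (x, y) \<Rightarrow> single (m a x, m b y) (1::'b)) \<subseteq> D \<times> D"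
      using m by (simp add: case_prod_beta')
  qed
  then show ?thesis
    unfolding free_map2_def lin_ext_def[where u = w]
    by (intro order_trans[OF keys_sum] UN_least order_trans[OF fscale]) (simp add: case_prod_beta')
qed

context module_coalgebra
begin

text \<open>Scalars act through multiples of the unit of \<open>H\<close>, which makes every
  submodule a subspace.\<close>

lemma scale_eq_act: "scaleC k x = act (scaleH k 1) x"
  by (simp add: act_scale act_one)

lemma subspace_if_submodule: "submodule act D \<Longrightarrow> C.subspace D"
  unfolding submodule_def by (rule C.subspaceI) (simp_all add: scale_eq_act)

text \<open>The elements whose comultiplication has a representative supported on the square of the
  hull form a submodule \<open>?I\<close>. It contains \<open>S\<close>, hence the hull.\<close>

lemma hull_submodule_subcoalgebra:
  assumes S: "S \<subseteq> E" "E \<subseteq> submodule act hull S" and E: "subcoalgebra scaleC \<Delta>C E"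
  shows "subcoalgebra scaleC \<Delta>C (submodule act hull S)"
proof -
  let ?D = "submodule act hull S"
  have D: "submodule act ?D" by (rule hull_submodule)
  let ?I = "{x. \<exists>u\<in>\<Delta>C x. Poly_Mapping.keys u \<subseteq> ?D \<times> ?D}"
  have "act h x \<in> ?I" if "x \<in> ?I" for h x
  proof -
    from that obtain u where u: "u \<in> \<Delta>C x" "Poly_Mapping.keys u \<subseteq> ?D \<times> ?D" by blast
    have "free_map2 act (H.rep h) u \<in> \<Delta>C (act h x)"
      unfolding comult_act tensor2_map2_def
      using u(1) H.rep_in equiv_class_self[OF equiv_tensor2_rel] by fast
    moreover have "Poly_Mapping.keys (free_map2 act (H.rep h) u) \<subseteq> ?D \<times> ?D"
      using D by (intro keys_free_map2 u(2)) (simp add: submodule_def)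
    ultimately show ?thesis by blast
  qed
  moreover have "x + y \<in> ?I" if "x \<in> ?I" "y \<in> ?I" for x y
  proof -
    from that obtain u v where "u \<in> \<Delta>C x" "v \<in> \<Delta>C y"
      and "Poly_Mapping.keys u \<union> Poly_Mapping.keys v \<subseteq> ?D \<times> ?D" by blast
    then show ?thesis
      using C.comult_add_rep order_trans[OF Poly_Mapping.keys_add] by blast
  qed
  \<comment> \<open>Scaling a representative of \<open>\<Delta>C 0\<close> by 0 gives the
    representative 0, whose support is empty.\<close>
  moreover have "0 \<in> ?I"
    using C.comult_scale_rep[OF C.rep_in, of 0 0] by (intro CollectI bexI[of _ 0]) simp_all
  ultimately have "submodule act ?I" by (simp add: submodule_def)
  moreover have "S \<subseteq> ?I"
  proof
    fix x assume "x \<in> S"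
    then obtain u where "\<Delta>C x = tensor2_class scaleC u" "Poly_Mapping.keys u \<subseteq> E \<times> E"
      using E S(1) unfolding subcoalgebra_def by blast
    then show "x \<in> ?I"
      using equiv_class_self[OF equiv_tensor2_rel, of u scaleC] S(2) by blast
  qed
  ultimately have "?D \<subseteq> ?I" by (rule hull_minimal[rotated])
  then show ?thesis
    using subspace_if_submodule[OF D] C.comult_eq_class unfolding subcoalgebra_def by blast
qed

end

theorem proposition4p2:
  fixes scaleH :: "'k::field \<Rightarrow> 'h::ring_1 \<Rightarrow> 'h"
    and \<Delta>H :: "'h \<Rightarrow> ('h \<times> 'h \<Rightarrow>\<^sub>0 'k) set"
    and \<epsilon>H :: "'h \<Rightarrow> 'k"
    and scaleC :: "'k \<Rightarrow> 'c::ab_group_add \<Rightarrow> 'c"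
    and \<Delta>C :: "'c \<Rightarrow> ('c \<times> 'c \<Rightarrow>\<^sub>0 'k) set"
    and \<epsilon>C :: "'c \<Rightarrow> 'k"
    and act :: "'h \<Rightarrow> 'c \<Rightarrow> 'c"
    and F :: "'c set"
  assumes "bialgebra scaleH \<Delta>H \<epsilon>H"
    and "module_coalgebra scaleH \<Delta>H \<epsilon>H scaleC \<Delta>C \<epsilon>C act"
    and "finite F"
  shows "\<exists>D. F \<subseteq> D \<and> submodule act D \<and> subcoalgebra scaleC \<Delta>C D \<and> finitely_generated act D"
proof -
  interpret module_coalgebra scaleH \<Delta>H \<epsilon>H scaleC \<Delta>C \<epsilon>C act by fact
  obtain B where B: "finite B" "F \<subseteq> C.span B" "subcoalgebra scaleC \<Delta>C (C.span B)"
    using C.fundamental_theorem_of_coalgebras[OF \<open>finite F\<close>] .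
  \<comment> \<open>The hull of the finite set \<open>B\<close>, not of its span, makes finite
    generation immediate.\<close>
  let ?D = "submodule act hull B"
  have "C.span B \<subseteq> ?D"
    by (intro C.span_minimal hull_subset subspace_if_submodule hull_submodule)
  moreover from this have "subcoalgebra scaleC \<Delta>C ?D"
    by (rule hull_submodule_subcoalgebra[OF C.span_superset _ B(3)])
  ultimately show ?thesis
    using B(1,2) hull_submodule unfolding finitely_generated_def by blast
qed

end
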